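(* Let $m,n$ be positive integers, let $c_j\ge 0$ ($j\in[n]$) be real numbers, and suppose $d_{ij}>0$ for all $i\in[m]$, $j\in[n]$. Let $\chi^L$ be the mixed-binary set defined in the context. The following hold. (a) For any subsets of indices $I\subseteq[m]$, $J\subset[n]$ and any index $j'\in[n]\setminus J$, the inequality $$\sum_{i\in I}\sum_{j\in J\cup\{j'\}}x_{ij}-\Big(\sum_{i\in I}\max_{j\in[n]}d_{ij}-\sum_{j\in J}c_j\Big)y_{j'}\le\sum_{j\in J}c_j$$ is valid for $\mathrm{conv}(\chi^L)$. (b) Let $I\subseteq[m]$ and $J\subset[n]$ be two subsets of indices. If $\sum_{j\in J}c_j\le\sum_{i\in I}\max_{j\in J}d_{ij}$, then the inequality $$\sum_{i\in I}\sum_{j\in[n]}x_{ij}-\sum_{j'\in[n]\setminus J}\Big(\sum_{i\in I}\max_{j\in J\cup\{j'\}}d_{ij}-\sum_{j\in J}c_j\Big)y_{j'}\le\sum_{j\in J}c_j$$ is valid for $\mathrm{conv}(\chi^L)$.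
   Context: Notation: $[k]=\{1,\ldots,k\}$; a maximum over the empty set is taken to be $0$. The number $c_j$ is the capacity of a service center at location $j\in[n]$, and $d_{ij}$ is the demand attracted from customer site $i\in[m]$ by a service center at $j$. The set $\chi^L\subset\mathbb{R}^{mn}\times\mathbb{R}^n\times\mathbb{R}^{mn}$ consists of all $[x,y,q]$, with $x=(x_{ij})$, $y=(y_j)$, $q=(q_{ij})$, $i\in[m]$, $j\in[n]$, satisfying $\sum_{i=1}^m x_{ij}\le c_jy_j$ for all $j\in[n]$; $\sum_{j=1}^n x_{ij}\le\sum_{j=1}^n d_{ij}q_{ij}$ for all $i\in[m]$; $\sum_{j=1}^n q_{ij}\le1$ for all $i\in[m]$; $q_{ij}\le y_j$ for all $i\in[m]$, $j\in[n]$; $x_{ij}\ge0$, $q_{ij}\ge0$, $y_j\in\{0,1\}$ for all $i\in[m]$, $j\in[n]$. An inequality is valid for a set if every point of the set satisfies it. *)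

theory Defs
  imports "HOL-Analysis.Analysis"
begin

text \<open>
  The customer sites [m] and the locations [n] are the elements of finite index types
  \<open>'m\<close> and \<open>'n\<close> (so m, n are arbitrary positive integers), and a point \<open>[x, y, q]\<close> is an element
  of the real vector space \<open>(real^'n^'m) \<times> (real^'n) \<times> (real^'n^'m)\<close>, with
  \<open>x\<^sub>i\<^sub>j = x $ i $ j\<close>.
\<close>

definition chiL ::
  "('n::finite \<Rightarrow> real) \<Rightarrow> ('m::finite \<Rightarrow> 'n \<Rightarrow> real) \<Rightarrow>
    ((real^'n^'m) \<times> (real^'n) \<times> (real^'n^'m)) set" where
  "chiL c d = {(x, y, q).
     (\<forall>j. (\<Sum>i\<in>UNIV. x $ i $ j) \<le> c j * y $ j) \<and>
     (\<forall>i. (\<Sum>j\<in>UNIV. x $ i $ j) \<le> (\<Sum>j\<in>UNIV. d i j * q $ i $ j)) \<and>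
     (\<forall>i. (\<Sum>j\<in>UNIV. q $ i $ j) \<le> 1) \<and>
     (\<forall>i j. q $ i $ j \<le> y $ j) \<and>
     (\<forall>i j. 0 \<le> x $ i $ j) \<and>
     (\<forall>i j. 0 \<le> q $ i $ j) \<and>
     (\<forall>j. y $ j \<in> {0, 1})}"

text \<open>\<^const>\<open>Max\<close> is unspecified on the empty set, where the maximum is taken to be 0 here.\<close>

definition max_over :: "('a \<Rightarrow> real) \<Rightarrow> 'a set \<Rightarrow> real" where
  "max_over f A = (if A = {} then 0 else Max (f ` A))"

end

theory Submission
  imports Defs
begin

text \<open>
  It suffices to check the inequalities on the mixed-binary set itself, since they are linear. In
  both parts the flow served is bounded by the capacities in \<open>J\<close> when no other relevant location is
  open, and otherwise by the demand: \<open>\<Sum>\<^sub>j d\<^sub>i\<^sub>j q\<^sub>i\<^sub>j \<le> B\<close> whenever \<open>B \<ge> 0\<close> bounds \<open>d\<^sub>i\<^sub>j\<close> for all open \<open>j\<close>.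
  For (b), the bound \<open>B = M(J) + (\<Sum>\<^sub>j\<^sub>'\<^sub>\<notin>\<^sub>J (M(J \<union> {j'}) - M(J)) y\<^sub>j\<^sub>')\<close> with \<open>M(A) = max\<^sub>j\<^sub>\<in>\<^sub>A d\<^sub>i\<^sub>j\<close> is used;
  replacing \<open>\<Sum>\<^sub>i M(J)\<close> by the smaller \<open>\<Sum>\<^sub>J c\<close> only weakens it as soon as some \<open>j' \<notin> J\<close> is open.
\<close>

lemma max_over_ge:
  assumes "finite A" "j \<in> A"
  shows "f j \<le> max_over f A"
  using assms by (auto simp: max_over_def)

lemma max_over_nonneg:
  assumes "finite A" "\<And>j. 0 \<le> f j"
  shows "0 \<le> max_over f A"
proof (cases "A = {}")
  case False
  then obtain j where "j \<in> A" by blast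
  then show ?thesis
    using max_over_ge[OF assms(1), of j f] assms(2)[of j] by linarith
qed (simp add: max_over_def)

text \<open>The case \<open>A = {}\<close> is where nonnegativity of \<open>f\<close> enters: the
  maximum there is 0 by convention.\<close>

lemma max_over_mono:
  assumes "finite B" "A \<subseteq> B" "\<And>j. 0 \<le> f j"
  shows "max_over f A \<le> max_over f B"
proof (cases "A = {}")
  case True
  then show ?thesis
    using max_over_nonneg[OF assms(1,3)] by (simp add: max_over_def)
next
  case False
  then show ?thesis
    using assms(1,2) by (auto simp: max_over_def intro!: Max_mono)
qed

text \<open>The points with \<open>f p \<le> b\<close> form a half-space, a convex set containing
  \<open>S\<close>. This carries both inequalities from \<open>chiL c d\<close> to its convex
  hull.\<close>

lemma linear_le_convex_hull:
  fixes f :: "'a::real_vector \<Rightarrow> real"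
  assumes "linear f" "p \<in> convex hull S" "\<And>p. p \<in> S \<Longrightarrow> f p \<le> b"
  shows "f p \<le> b"
proof -
  have "convex (f -` {..b})"
    by (intro convex_linear_vimage assms(1)) simp
  then have "convex hull S \<subseteq> f -` {..b}"
    using assms(3) by (intro hull_minimal) auto
  then show ?thesis
    using assms(2) by auto
qed

lemma chiL_capacity:
  assumes "(x, y, q) \<in> chiL c d"
  shows "(\<Sum>i\<in>I. \<Sum>j\<in>J. x $ i $ j) \<le> (\<Sum>j\<in>J. c j * y $ j)"
proof -
  have "(\<Sum>i\<in>I. \<Sum>j\<in>J. x $ i $ j) = (\<Sum>j\<in>J. \<Sum>i\<in>I. x $ i $ j)"
    by (rule sum.swap)
  also have "\<dots> \<le> (\<Sum>j\<in>J. c j * y $ j)"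
  proof (rule sum_mono)
    fix j
    have "(\<Sum>i\<in>I. x $ i $ j) \<le> (\<Sum>i\<in>UNIV. x $ i $ j)"
      using assms by (intro sum_mono2) (auto simp: chiL_def)
    also have "\<dots> \<le> c j * y $ j"
      using assms by (auto simp: chiL_def)
    finally show "(\<Sum>i\<in>I. x $ i $ j) \<le> c j * y $ j" .
  qed
  finally show ?thesis .
qed

text \<open>Locations of \<open>K\<close> outside \<open>J\<close> are closed and so carry no flow;
  those in \<open>K \<inter> J\<close> carry at most their capacity, and adding the remaining
  capacities of \<open>J\<close> only increases the bound.\<close>

lemma chiL_capacity_le_sum:
  assumes "(x, y, q) \<in> chiL c d" "\<And>j. 0 \<le> c j"
    and closed: "\<And>j. j \<in> K - J \<Longrightarrow> y $ j = 0"
  shows "(\<Sum>i\<in>I. \<Sum>j\<in>K. x $ i $ j) \<le> (\<Sum>j\<in>J. c j)"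
proof -
  have y: "y $ j = 0 \<or> y $ j = 1" for j
    using assms(1) by (auto simp: chiL_def)
  have "(\<Sum>i\<in>I. \<Sum>j\<in>K. x $ i $ j) \<le> (\<Sum>j\<in>K. c j * y $ j)"
    using assms(1) by (rule chiL_capacity)
  also have "\<dots> = (\<Sum>j\<in>K \<inter> J. c j * y $ j)"
    using closed by (intro sum.mono_neutral_right) auto
  also have "\<dots> \<le> (\<Sum>j\<in>K \<inter> J. c j)"
  proof (rule sum_mono)
    fix j
    show "c j * y $ j \<le> c j"
      using y[of j] assms(2)[of j] by auto
  qed
  also have "\<dots> \<le> (\<Sum>j\<in>J. c j)"
    using assms(2) by (intro sum_mono2) auto
  finally show ?thesis .
qed

text \<open>The row \<open>q $ i\<close> is nonnegative, vanishes at closed locations and sums to at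
  most 1. Hence the weighted demand is at most \<open>B\<close> times that sum, and
  \<open>0 \<le> B\<close> turns this into \<open>B\<close>.\<close>

lemma chiL_demand:
  assumes "(x, y, q) \<in> chiL c d" "0 \<le> B"
    and bound: "\<And>j. y $ j = 1 \<Longrightarrow> d i j \<le> B"
  shows "(\<Sum>j\<in>K. x $ i $ j) \<le> B"
proof -
  have "(\<Sum>j\<in>K. x $ i $ j) \<le> (\<Sum>j\<in>UNIV. x $ i $ j)"
    using assms(1) by (intro sum_mono2) (auto simp: chiL_def)
  also have "\<dots> \<le> (\<Sum>j\<in>UNIV. d i j * q $ i $ j)"
    using assms(1) by (auto simp: chiL_def)
  also have "\<dots> \<le> (\<Sum>j\<in>UNIV. B * q $ i $ j)"
  proof (rule sum_mono)
    fix j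
    have q: "0 \<le> q $ i $ j" "q $ i $ j \<le> y $ j" and y: "y $ j = 0 \<or> y $ j = 1"
      using assms(1) by (auto simp: chiL_def)
    show "d i j * q $ i $ j \<le> B * q $ i $ j"
    proof (cases "y $ j = 0")
      case True
      then have "q $ i $ j = 0" using q by linarith
      then show ?thesis by simp
    next
      case False
      then show ?thesis using y q bound by (intro mult_right_mono) auto
    qed
  qed
  also have "\<dots> = B * (\<Sum>j\<in>UNIV. q $ i $ j)"
    by (simp add: sum_distrib_left)
  also have "\<dots> \<le> B * 1"
    using assms(1,2) by (intro mult_left_mono) (auto simp: chiL_def)
  finally show ?thesis by simp
qed

text \<open>If \<open>j'\<close> is closed, the capacities in \<open>J\<close> bound the flow. If it
  is open, the capacity sums on the two sides cancel and the demand bound remains.\<close>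

lemma chiL_single_location:
  assumes "(x, y, q) \<in> chiL c d" "\<And>j. 0 \<le> c j" "\<And>i j. 0 \<le> d i j"
  shows "(\<Sum>i\<in>I. \<Sum>j\<in>J \<union> {j'}. x $ i $ j)
      - ((\<Sum>i\<in>I. max_over (d i) UNIV) - (\<Sum>j\<in>J. c j)) * y $ j' \<le> (\<Sum>j\<in>J. c j)"
proof (cases "y $ j' = 0")
  case True
  then show ?thesis
    using chiL_capacity_le_sum[OF assms(1,2), of "J \<union> {j'}" J I] by auto
next
  case False
  then have "y $ j' = 1"
    using assms(1) by (auto simp: chiL_def)
  moreover have "(\<Sum>i\<in>I. \<Sum>j\<in>J \<union> {j'}. x $ i $ j) \<le> (\<Sum>i\<in>I. max_over (d i) UNIV)"
    using assms(3)
    by (intro sum_mono chiL_demand[OF assms(1)] max_over_nonneg max_over_ge) auto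
  ultimately show ?thesis by simp
qed

lemma chiL_all_locations:
  assumes "(x, y, q) \<in> chiL c d" "\<And>j. 0 \<le> c j" "\<And>i j. 0 \<le> d i j"
    and C: "(\<Sum>j\<in>J. c j) \<le> (\<Sum>i\<in>I. max_over (d i) J)"
  shows "(\<Sum>i\<in>I. \<Sum>j\<in>UNIV. x $ i $ j)
      - (\<Sum>j'\<in>UNIV - J. ((\<Sum>i\<in>I. max_over (d i) (J \<union> {j'})) - (\<Sum>j\<in>J. c j)) * y $ j')
      \<le> (\<Sum>j\<in>J. c j)"
proof (cases "\<exists>k. k \<notin> J \<and> y $ k = 1")
  case False
  have y: "y $ j = 0 \<or> y $ j = 1" for j
    using assms(1) by (auto simp: chiL_def)
  with False have closed: "y $ j = 0" if "j \<in> UNIV - J" for j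
    using that by blast
  have "(\<Sum>i\<in>I. \<Sum>j\<in>UNIV. x $ i $ j) \<le> (\<Sum>j\<in>J. c j)"
    using assms(1,2) closed by (rule chiL_capacity_le_sum)
  moreover have "(\<Sum>j'\<in>UNIV - J.
      ((\<Sum>i\<in>I. max_over (d i) (J \<union> {j'})) - (\<Sum>j\<in>J. c j)) * y $ j') = 0"
    using closed by (intro sum.neutral) simp
  ultimately show ?thesis by linarith
next
  case True
  then obtain k where k: "k \<notin> J" "y $ k = 1" by blast
  have y: "0 \<le> y $ j" for j
    using assms(1) by (auto simp: chiL_def dest: spec[of _ j])
  define M where "M i A = max_over (d i) A" for i A
  define D where "D A = (\<Sum>i\<in>I. M i A)" for A
  \<comment> \<open>As \<open>y\<close> is binary, \<open>s\<close> counts the open locations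
    outside \<open>J\<close>; the location \<open>k\<close> makes it at least 1.\<close>
  define s where "s = (\<Sum>j'\<in>UNIV - J. y $ j')"
  \<comment> \<open>All gains are nonnegative, so \<open>B i\<close> dominates \<open>M i J\<close>
    as well as \<open>M i (J \<union> {j'})\<close> for each open \<open>j'\<close> outside
    \<open>J\<close>. It therefore bounds the demand at every open location.\<close>
  define B where "B i = M i J + (\<Sum>j'\<in>UNIV - J. (M i (J \<union> {j'}) - M i J) * y $ j')" for i
  have gain: "0 \<le> (M i (J \<union> {j'}) - M i J) * y $ j'" for i j'
    unfolding M_def using assms(3) y
    by (intro mult_nonneg_nonneg) (auto intro!: max_over_mono)
  have M_le_B: "M i J \<le> B i" for i
    unfolding B_def using gain by (simp add: sum_nonneg)
  have "0 \<le> B i" for i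
    using max_over_nonneg[of J "d i"] M_le_B[of i] assms(3) by (fastforce simp: M_def)
  moreover have "d i j \<le> B i" if "y $ j = 1" for i j
  proof (cases "j \<in> J")
    case True
    then show ?thesis
      using max_over_ge[of J j "d i"] M_le_B[of i] by (simp add: M_def)
  next
    case False
    then have "(M i (J \<union> {j}) - M i J) * y $ j
        \<le> (\<Sum>j'\<in>UNIV - J. (M i (J \<union> {j'}) - M i J) * y $ j')"
      using gain by (intro member_le_sum) auto
    moreover have "d i j \<le> M i (J \<union> {j})"
      unfolding M_def by (rule max_over_ge) auto
    ultimately show ?thesis
      using that by (simp add: B_def)
  qed
  ultimately have "(\<Sum>i\<in>I. \<Sum>j\<in>UNIV. x $ i $ j) \<le> (\<Sum>i\<in>I. B i)"
    by (intro sum_mono chiL_demand[OF assms(1)]) auto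
  also have "\<dots> = D J + (\<Sum>j'\<in>UNIV - J. (D (J \<union> {j'}) - D J) * y $ j')"
    unfolding B_def D_def sum.distrib
    by (subst sum.swap) (simp add: sum_subtractf flip: sum_distrib_right)
  finally have flow: "(\<Sum>i\<in>I. \<Sum>j\<in>UNIV. x $ i $ j)
      \<le> D J + (\<Sum>j'\<in>UNIV - J. (D (J \<union> {j'}) - D J) * y $ j')" .
  \<comment> \<open>Used with \<open>a = D J\<close> and with \<open>a\<close> the capacity of
    \<open>J\<close>: the two sums differ only in the term \<open>a * s\<close>.\<close>
  have shift: "(\<Sum>j'\<in>UNIV - J. (D (J \<union> {j'}) - a) * y $ j')
      = (\<Sum>j'\<in>UNIV - J. D (J \<union> {j'}) * y $ j') - a * s" for a
    by (simp add: s_def left_diff_distrib sum_subtractf sum_distrib_left)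
  have "y $ k \<le> s"
    unfolding s_def using k y by (intro member_le_sum) auto
  \<comment> \<open>This product is exactly the slack gained when the capacity of \<open>J\<close>
    replaces \<open>D J\<close>; the assumption \<open>C\<close> and \<open>1 \<le> s\<close> make
    its factors nonnegative.\<close>
  then have "0 \<le> (D J - (\<Sum>j\<in>J. c j)) * (s - 1)"
    using C k by (intro mult_nonneg_nonneg) (auto simp: D_def M_def)
  then have "D J - D J * s \<le> (\<Sum>j\<in>J. c j) - (\<Sum>j\<in>J. c j) * s"
    by (simp add: algebra_simps)
  then have "(\<Sum>i\<in>I. \<Sum>j\<in>UNIV. x $ i $ j)
      - (\<Sum>j'\<in>UNIV - J. (D (J \<union> {j'}) - (\<Sum>j\<in>J. c j)) * y $ j') \<le> (\<Sum>j\<in>J. c j)"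
    using flow unfolding shift by linarith
  then show ?thesis
    by (simp add: D_def M_def)
qed

text \<open>Common form of both left-hand sides: \<open>L\<close> is \<open>{j'}\<close> in the
  first inequality and \<open>UNIV - J\<close> in the second.\<close>

lemma linear_flow_minus_open:
  fixes a :: "'n::finite \<Rightarrow> real"
  shows "linear (\<lambda>p :: (real^'n^'m::finite) \<times> (real^'n) \<times> (real^'n^'m).
    (\<Sum>i\<in>I. \<Sum>j\<in>K. fst p $ i $ j) - (\<Sum>j\<in>L. a j * fst (snd p) $ j))"
  by (rule linearI) (simp_all add: sum.distrib sum_distrib_left algebra_simps)

theorem theorem2:
  fixes c :: "'n::finite \<Rightarrow> real"
    and d :: "'m::finite \<Rightarrow> 'n \<Rightarrow> real"
  assumes "\<And>j. 0 \<le> c j"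
    and "\<And>i j. 0 < d i j"
  shows "(\<forall>(I::'m set) (J::'n set) j'. I \<subseteq> UNIV \<longrightarrow> J \<subset> UNIV \<longrightarrow> j' \<in> UNIV - J \<longrightarrow>
           (\<forall>(x, y, q) \<in> convex hull (chiL c d).
              (\<Sum>i\<in>I. \<Sum>j\<in>J \<union> {j'}. x $ i $ j)
                - ((\<Sum>i\<in>I. max_over (d i) UNIV) - (\<Sum>j\<in>J. c j)) * y $ j'
              \<le> (\<Sum>j\<in>J. c j))) \<and>
         (\<forall>(I::'m set) (J::'n set). I \<subseteq> UNIV \<longrightarrow> J \<subset> UNIV \<longrightarrow>
           (\<Sum>j\<in>J. c j) \<le> (\<Sum>i\<in>I. max_over (d i) J) \<longrightarrow>
           (\<forall>(x, y, q) \<in> convex hull (chiL c d).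
              (\<Sum>i\<in>I. \<Sum>j\<in>UNIV. x $ i $ j)
                - (\<Sum>j'\<in>UNIV - J.
                     ((\<Sum>i\<in>I. max_over (d i) (J \<union> {j'})) - (\<Sum>j\<in>J. c j)) * y $ j')
              \<le> (\<Sum>j\<in>J. c j)))"
proof (intro conjI allI impI ballI)
  note d = less_imp_le[OF assms(2)]
  fix I :: "'m set" and J :: "'n set" and j' p
  assume "p \<in> convex hull (chiL c d)"
  from linear_flow_minus_open[where I = I and K = "J \<union> {j'}" and L = "{j'}"] this
  have "(\<Sum>i\<in>I. \<Sum>j\<in>J \<union> {j'}. fst p $ i $ j)
      - (\<Sum>j\<in>{j'}. ((\<Sum>i\<in>I. max_over (d i) UNIV) - (\<Sum>j\<in>J. c j)) * fst (snd p) $ j)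
      \<le> (\<Sum>j\<in>J. c j)"
  proof (rule linear_le_convex_hull)
    fix p assume "p \<in> chiL c d"
    then show "(\<Sum>i\<in>I. \<Sum>j\<in>J \<union> {j'}. fst p $ i $ j)
      - (\<Sum>j\<in>{j'}. ((\<Sum>i\<in>I. max_over (d i) UNIV) - (\<Sum>j\<in>J. c j)) * fst (snd p) $ j)
      \<le> (\<Sum>j\<in>J. c j)"
      using chiL_single_location[OF _ assms(1) d, where x = "fst p" and y = "fst (snd p)"
          and q = "snd (snd p)" and I = I and J = J and j' = j']
      by simp
  qed
  then show "case p of (x, y, q) \<Rightarrow> (\<Sum>i\<in>I. \<Sum>j\<in>J \<union> {j'}. x $ i $ j)
      - ((\<Sum>i\<in>I. max_over (d i) UNIV) - (\<Sum>j\<in>J. c j)) * y $ j' \<le> (\<Sum>j\<in>J. c j)"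
    by (simp add: case_prod_beta)
next
  note d = less_imp_le[OF assms(2)]
  fix I :: "'m set" and J :: "'n set" and p
  assume C: "(\<Sum>j\<in>J. c j) \<le> (\<Sum>i\<in>I. max_over (d i) J)"
  assume "p \<in> convex hull (chiL c d)"
  from linear_flow_minus_open[where I = I and K = UNIV and L = "UNIV - J"] this
  have "(\<Sum>i\<in>I. \<Sum>j\<in>UNIV. fst p $ i $ j)
      - (\<Sum>j'\<in>UNIV - J. ((\<Sum>i\<in>I. max_over (d i) (J \<union> {j'})) - (\<Sum>j\<in>J. c j))
          * fst (snd p) $ j') \<le> (\<Sum>j\<in>J. c j)"
  proof (rule linear_le_convex_hull)
    fix p assume "p \<in> chiL c d"
    then show "(\<Sum>i\<in>I. \<Sum>j\<in>UNIV. fst p $ i $ j)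
      - (\<Sum>j'\<in>UNIV - J. ((\<Sum>i\<in>I. max_over (d i) (J \<union> {j'})) - (\<Sum>j\<in>J. c j))
          * fst (snd p) $ j') \<le> (\<Sum>j\<in>J. c j)"
      using chiL_all_locations[OF _ assms(1) d C, where x = "fst p" and y = "fst (snd p)"
          and q = "snd (snd p)"]
      by simp
  qed
  then show "case p of (x, y, q) \<Rightarrow> (\<Sum>i\<in>I. \<Sum>j\<in>UNIV. x $ i $ j)
      - (\<Sum>j'\<in>UNIV - J. ((\<Sum>i\<in>I. max_over (d i) (J \<union> {j'})) - (\<Sum>j\<in>J. c j)) * y $ j')
      \<le> (\<Sum>j\<in>J. c j)"
    by (simp add: case_prod_beta)
qed

end
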